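(* Let $G$ be a graph and $k$ a positive integer. Then $\mathsf{tree}\text{-}\alpha(G^{k+2})\le \mathsf{tree}\text{-}\alpha(G^k)$.
   Context: For a graph $G$ and a positive integer $k$, the $k$-th power $G^k$ is the graph on $V(G)$ in which two distinct vertices are adjacent iff their distance in $G$ is at most $k$. A tree decomposition of $G$ is a pair $(T,\{X_t\}_{t\in V(T)})$ with $T$ a tree and bags $X_t\subseteq V(G)$ such that every vertex lies in some bag, every edge has both endpoints in some bag, and for every vertex $u$ the nodes whose bags contain $u$ induce a connected subtree of $T$. The independence number of a tree decomposition $\mathcal T$ is $\alpha(\mathcal T)=\max_{t\in V(T)}\alpha(G[X_t])$, where $\alpha$ denotes the maximum size of an independent set. The tree-independence number $\mathsf{tree}\text{-}\alpha(G)$ is the minimum of $\alpha(\mathcal T)$ over all tree decompositions $\mathcal T$ of $G$. *)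

theory Defs
  imports "Graph_Theory.Graph_Theory"
begin

text \<open>
  Graphs are finite simple graphs, given by the locale \<^locale>\<open>graph\<close> of symmetric digraphs
  without loops and parallel arcs; each undirected edge is a pair of opposite arcs.
\<close>

text \<open>The distance is \<open>\<infinity>\<close> if \<open>v\<close> is not reachable from \<open>u\<close>.\<close>

definition graph_dist :: "('a,'b) pre_digraph \<Rightarrow> 'a \<Rightarrow> 'a \<Rightarrow> ereal" where
  "graph_dist G u v = wf_digraph.\<mu> G (\<lambda>_. 1) u v"

definition graph_power :: "('a,'b) pre_digraph \<Rightarrow> nat \<Rightarrow> 'a pair_pre_digraph" where
  "graph_power G k =
     \<lparr> pverts = verts G,
       parcs = {(u,v). u \<in> verts G \<and> v \<in> verts G \<and> u \<noteq> v \<and> graph_dist G u v \<le> ereal (real k)} \<rparr>"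

definition independent_set :: "('a,'b) pre_digraph \<Rightarrow> 'a set \<Rightarrow> bool" where
  "independent_set G S \<longleftrightarrow> S \<subseteq> verts G \<and> (\<forall>u\<in>S. \<forall>v\<in>S. \<not> u \<rightarrow>\<^bsub>G\<^esub> v)"

definition independence_number :: "('a,'b) pre_digraph \<Rightarrow> nat" where
  "independence_number G = Max {card S | S. independent_set G S}"

text \<open>
  The library predicate \<^const>\<open>tree\<close> is not usable for symmetric digraphs: it forbids every
  directed cycle, including the closed walk \<open>u, v, u\<close> along one undirected edge. The
  cycles of an undirected simple graph are the directed ones with at least three arcs.
  Connectedness includes that there is at least one vertex.
\<close>

definition undirected_tree :: "('t,'b) pre_digraph \<Rightarrow> bool" where
  "undirected_tree T \<longleftrightarrow> graph T \<and> Digraph_Component.connected T \<and>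
     \<not> (\<exists>p. pre_digraph.cycle T p \<and> length p \<ge> 3)"

definition tree_decomposition ::
    "('a,'b) pre_digraph \<Rightarrow> 't pair_pre_digraph \<Rightarrow> ('t \<Rightarrow> 'a set) \<Rightarrow> bool" where
  "tree_decomposition G T X \<longleftrightarrow>
     undirected_tree (with_proj T) \<and>
     (\<forall>t\<in>pverts T. X t \<subseteq> verts G) \<and>
     (\<forall>u\<in>verts G. \<exists>t\<in>pverts T. u \<in> X t) \<and>
     (\<forall>u v. u \<rightarrow>\<^bsub>G\<^esub> v \<longrightarrow> (\<exists>t\<in>pverts T. u \<in> X t \<and> v \<in> X t)) \<and>
     (\<forall>u\<in>verts G. Digraph_Component.connected (with_proj T \<restriction> {t \<in> pverts T. u \<in> X t}))"

definition decomposition_alpha ::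
    "('a,'b) pre_digraph \<Rightarrow> 't pair_pre_digraph \<Rightarrow> ('t \<Rightarrow> 'a set) \<Rightarrow> nat" where
  "decomposition_alpha G T X = Max ((\<lambda>t. independence_number (G \<restriction> X t)) ` pverts T)"

text \<open>
  Every finite tree is isomorphic to one whose nodes are natural numbers, so fixing the type
  of the nodes loses no decomposition. The minimum is attained, see
  \<open>tree_alpha_attained\<close> below.
\<close>

definition tree_alpha :: "('a,'b) pre_digraph \<Rightarrow> nat" where
  "tree_alpha G = (LEAST n. \<exists>(T :: nat pair_pre_digraph) X.
     tree_decomposition G T X \<and> n = decomposition_alpha G T X)"


lemma (in sym_digraph) awalk_reverse:
  assumes "awalk u p v"
  shows "\<exists>q. awalk v q u \<and> length q = length p"
  using assms
proof (induction p arbitrary: u)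
  case Nil
  then show ?case by (auto simp: awalk_Nil_iff)
next
  case (Cons e p)
  then have e: "e \<in> arcs G" "tail G e = u" and p: "awalk (head G e) p v"
    by (auto simp: awalk_Cons_iff)
  from Cons.IH[OF p] obtain q where q: "awalk v q (head G e)" "length q = length p" by blast
  from sym_arcs e(1) obtain e' where e': "e' \<in> arcs G" "tail G e' = head G e" "head G e' = tail G e"
    unfolding symmetric_conv by metis
  have "awalk (head G e) [e'] u"
    using e e' by (auto simp: awalk_Cons_iff awalk_Nil_iff)
  with q have "awalk v (q @ [e']) u" by (blast intro: awalk_appendI)
  with q(2) show ?case by (intro exI[of _ "q @ [e']"]) simp
qed

lemma (in wf_digraph) graph_dist_conv_length:
  "graph_dist G u v = (INF p\<in>{p. awalk u p v}. ereal (real (length p)))"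
proof -
  have "awalk_cost (\<lambda>_. 1) p = real (length p)" for p :: "'b list"
    by (induction p) auto
  then show ?thesis by (simp add: graph_dist_def \<mu>_def)
qed

lemma (in wf_digraph) graph_dist_le_iff:
  "graph_dist G u v \<le> ereal (real k) \<longleftrightarrow> (\<exists>p. awalk u p v \<and> length p \<le> k)"
proof
  assume "graph_dist G u v \<le> ereal (real k)"
  also have "\<dots> < ereal (real (Suc k))" by simp
  finally obtain p where "awalk u p v" "ereal (real (length p)) < ereal (real (Suc k))"
    unfolding graph_dist_conv_length INF_less_iff by auto
  then show "\<exists>p. awalk u p v \<and> length p \<le> k" by auto
next
  assume "\<exists>p. awalk u p v \<and> length p \<le> k"
  then show "graph_dist G u v \<le> ereal (real k)"
    unfolding graph_dist_conv_length by (auto intro!: INF_lower2)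
qed

lemma (in graph) graph_graph_power: "graph (with_proj (graph_power G k))"
proof -
  have fin: "finite (parcs (graph_power G k))"
    by (rule finite_subset[of _ "verts G \<times> verts G"]) (auto simp: graph_power_def)
  have dist: "graph_dist G v u \<le> ereal (real k)" if "graph_dist G u v \<le> ereal (real k)" for u v
    using that awalk_reverse unfolding graph_dist_le_iff by metis
  show ?thesis
    using fin dist
    by unfold_locales
       (auto simp: graph_power_def arc_to_ends_def symmetric_def sym_def)
qed

lemma (in graph) tree_decomposition_single_bag:
  "tree_decomposition G \<lparr> pverts = {0 :: nat}, parcs = {} \<rparr> (\<lambda>_. verts G)"
proof -
  let ?T = "\<lparr> pverts = {0 :: nat}, parcs = {} \<rparr>"
  have g: "graph (with_proj ?T)"
    by unfold_locales (auto simp: symmetric_def sym_def)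
  have c: "Digraph_Component.connected (with_proj ?T)"
    by (auto simp: Digraph_Component.connected_def strongly_connected_def mk_symmetric_def
        reachable_def intro: rtrancl_on.intros)
  have c': "Digraph_Component.connected (with_proj ?T \<restriction> {0})"
    by (auto simp: Digraph_Component.connected_def strongly_connected_def mk_symmetric_def
        reachable_def induce_subgraph_def intro: rtrancl_on.intros)
  have n: "\<not> (\<exists>p. pre_digraph.cycle (with_proj ?T) p \<and> length p \<ge> 3)"
    by (auto simp: pre_digraph.cycle_def pre_digraph.awalk_def)
  show ?thesis
    using g c c' n by (auto simp: tree_decomposition_def undirected_tree_def adj_in_verts)
qed

lemma (in graph) tree_alpha_attained:
  "\<exists>(T :: nat pair_pre_digraph) X.
     tree_decomposition G T X \<and> tree_alpha G = decomposition_alpha G T X"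
  unfolding tree_alpha_def
  by (rule LeastI_ex) (use tree_decomposition_single_bag in blast)

end

theory Submission
  imports Defs
begin

text \<open>
  Keep the tree of an optimal decomposition of \<open>G\<^sup>k\<close> and enlarge every bag to its closed
  neighbourhood in \<open>G\<close>. The nodes whose new bag contains \<open>u\<close> form the union of the subtrees of
  \<open>u\<close> and of its neighbours, and each of these meets the subtree of \<open>u\<close> because \<open>k \<ge> 1\<close>. The middle
  part of a path of length at most \<open>k + 2\<close> has length at most \<open>k\<close>, so the new bags cover the edges
  of \<open>G\<^bsup>k+2\<^esup>\<close>. Moving the vertices of an independent set of \<open>G\<^bsup>k+2\<^esup>\<close> in a new bag to
  neighbours in the old bag keeps them at distance greater than \<open>k\<close>, so the independence number of
  no bag increases.
\<close>

lemma (in graph) graph_dist_commute_le: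
  "graph_dist G u v \<le> ereal (real k) \<Longrightarrow> graph_dist G v u \<le> ereal (real k)"
  using awalk_reverse unfolding graph_dist_le_iff by metis

lemma (in wf_digraph) graph_dist_le_trans:
  assumes "graph_dist G u v \<le> ereal (real i)" and "graph_dist G v w \<le> ereal (real j)"
  shows "graph_dist G u w \<le> ereal (real (i + j))"
proof -
  from assms obtain p q where "awalk u p v" "length p \<le> i" "awalk v q w" "length q \<le> j"
    unfolding graph_dist_le_iff by blast
  then have "awalk u (p @ q) w" "length (p @ q) \<le> i + j"
    by (blast intro: awalk_appendI, simp)
  then show ?thesis unfolding graph_dist_le_iff by blast
qed

text \<open>Cut a walk after its first \<open>i\<close> arcs. If it has fewer,
  \<open>drop i p\<close> is empty and \<open>v = w\<close>, so no exact distance has to be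
  matched.\<close>

lemma (in wf_digraph) graph_dist_le_split:
  assumes "graph_dist G u w \<le> ereal (real (i + j))"
  obtains v where "graph_dist G u v \<le> ereal (real i)" "graph_dist G v w \<le> ereal (real j)"
proof -
  from assms obtain p where p: "awalk u p w" "length p \<le> i + j"
    unfolding graph_dist_le_iff by blast
  then have "awalk u (take i p @ drop i p) w" by simp
  then obtain v where "awalk u (take i p) v" "awalk v (drop i p) w"
    unfolding awalk_append_iff by blast
  moreover have "length (take i p) \<le> i" "length (drop i p) \<le> j" using p(2) by simp_all
  ultimately show thesis using that unfolding graph_dist_le_iff by blast
qed

lemma (in wf_digraph) graph_dist_le_in_verts:
  assumes "graph_dist G u v \<le> ereal (real k)"
  shows "u \<in> verts G" and "v \<in> verts G"
  using assms awalk_hd_in_verts awalk_last_in_verts unfolding graph_dist_le_iff by blast+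

lemma (in wf_digraph) graph_dist_refl_le:
  "u \<in> verts G \<Longrightarrow> graph_dist G u u \<le> ereal (real k)"
  unfolding graph_dist_le_iff by (intro exI[of _ "[]"]) (simp add: awalk_Nil_iff)

lemma (in wf_digraph) dominates_graph_power_iff:
  "u \<rightarrow>\<^bsub>with_proj (graph_power G k)\<^esub> v \<longleftrightarrow> u \<noteq> v \<and> graph_dist G u v \<le> ereal (real k)"
  using graph_dist_le_in_verts by (auto simp: graph_power_def)

lemma dominates_induce_subgraph_iff:
  "u \<rightarrow>\<^bsub>G \<restriction> X\<^esub> v \<longleftrightarrow> u \<in> X \<and> v \<in> X \<and> u \<rightarrow>\<^bsub>G\<^esub> v"
  by (auto simp: arcs_ends_conv)

lemma finite_card_independent_sets:
  assumes "finite (verts G)"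
  shows "finite {card S |S. independent_set G S}"
  by (rule finite_subset[of _ "card ` Pow (verts G)"])
     (use assms in \<open>auto simp: independent_set_def\<close>)

lemma independence_number_le:
  assumes "finite (verts G)" and "finite (verts H)"
    and "\<And>S. independent_set G S \<Longrightarrow> \<exists>S'. independent_set H S' \<and> card S \<le> card S'"
  shows "independence_number G \<le> independence_number H"
  unfolding independence_number_def
proof (rule Max.boundedI)
  show "finite {card S |S. independent_set G S}"
    by (rule finite_card_independent_sets) fact
  have "independent_set G {}" by (simp add: independent_set_def)
  then show "{card S |S. independent_set G S} \<noteq> {}" by blast
  fix n assume "n \<in> {card S |S. independent_set G S}"
  with assms(3) obtain S' where "independent_set H S'" "n \<le> card S'" by blast
  then show "n \<le> Max {card S |S. independent_set H S}"
    using finite_card_independent_sets[OF assms(2)] by (blast intro: Max.coboundedI order_trans)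
qed

text \<open>The set \<open>A\<close> acts as a hub: from any \<open>B\<close> one passes through a
  common vertex into \<open>A\<close>, and there to a fixed vertex \<open>a\<close>. Below,
  \<open>A\<close> is the subtree of a vertex and the sets \<open>B\<close> are the subtrees of its
  neighbours.\<close>

lemma (in wf_digraph) connected_induce_subgraph_Union:
  assumes A: "Digraph_Component.connected (G \<restriction> A)"
    and B: "\<And>B. B \<in> \<B> \<Longrightarrow> Digraph_Component.connected (G \<restriction> B)"
    and meet: "\<And>B. B \<in> \<B> \<Longrightarrow> A \<inter> B \<noteq> {}"
    and sub: "A \<subseteq> verts G" "\<And>B. B \<in> \<B> \<Longrightarrow> B \<subseteq> verts G"
  shows "Digraph_Component.connected (G \<restriction> (A \<union> \<Union>\<B>))"
proof -
  let ?U = "A \<union> \<Union>\<B>"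
  let ?R = "\<lambda>u v. u \<rightarrow>\<^sup>*\<^bsub>with_proj (mk_symmetric (G \<restriction> ?U))\<^esub> v"
  interpret U: wf_digraph "G \<restriction> ?U" by unfold_locales auto
  interpret S: pair_wf_digraph "mk_symmetric (G \<restriction> ?U)" by (rule U.wellformed_mk_symmetric)
  \<comment> \<open>Enlarging the inducing set only adds vertices and arcs, also after
    symmetrisation, so connections inside a piece survive in the union.\<close>
  have mono: "?R u v"
    if C: "Digraph_Component.connected (G \<restriction> C)" "C \<subseteq> ?U" and uv: "u \<in> C" "v \<in> C" for C u v
  proof -
    have "u \<rightarrow>\<^sup>*\<^bsub>with_proj (mk_symmetric (G \<restriction> C))\<^esub> v"
      using C(1) uv by (auto simp: Digraph_Component.connected_def strongly_connected_def)
    moreover have "parcs (mk_symmetric (G \<restriction> C)) \<subseteq> parcs (mk_symmetric (G \<restriction> ?U))"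
      unfolding parcs_mk_symmetric by (rule UN_mono) (use C(2) in auto)
    ultimately show ?thesis
      using C(2) unfolding reachable_def by (elim rtrancl_on_mono[rotated 2]) simp_all
  qed
  from A obtain a where a: "a \<in> A"
    by (auto simp: Digraph_Component.connected_def strongly_connected_def)
  have to_a: "?R u a \<and> ?R a u" if "u \<in> ?U" for u
  proof (cases "u \<in> A")
    case True
    then show ?thesis using mono[OF A] a by blast
  next
    case False
    with that obtain B where B': "B \<in> \<B>" "u \<in> B" by blast
    with meet obtain b where b: "b \<in> A" "b \<in> B" by blast
    have "?R u b" "?R b u" using mono[OF B[OF B'(1)]] B' b by blast+
    moreover have "?R b a" "?R a b" using mono[OF A] a b by blast+
    ultimately show ?thesis by (blast intro: S.reachable_trans)
  qed
  show ?thesis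
    unfolding Digraph_Component.connected_def strongly_connected_def
    using a to_a by (auto intro: S.reachable_trans)
qed

text \<open>The bound 1 also admits distance 0, so this is the closed neighbourhood. Using distance
  instead of arcs lets the triangle inequality apply directly.\<close>

definition nbhd_bags :: "('a,'b) pre_digraph \<Rightarrow> ('t \<Rightarrow> 'a set) \<Rightarrow> 't \<Rightarrow> 'a set" where
  "nbhd_bags G X t = {u. \<exists>w\<in>X t. graph_dist G u w \<le> ereal (real 1)}"

lemma (in graph) tree_decomposition_nbhd_bags:
  assumes td: "tree_decomposition (with_proj (graph_power G k)) T X" and "k \<ge> 1"
  shows "tree_decomposition (with_proj (graph_power G (k + 2))) T (nbhd_bags G X)"
proof -
  let ?d = "\<lambda>u v i. graph_dist G u v \<le> ereal (real i)"
  have V: "verts (with_proj (graph_power G i)) = verts G" for i by (simp add: graph_power_def)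
  have T: "undirected_tree (with_proj T)"
    and cover: "\<And>u. u \<in> verts G \<Longrightarrow> \<exists>t\<in>pverts T. u \<in> X t"
    and edge: "\<And>u v. u \<noteq> v \<Longrightarrow> ?d u v k \<Longrightarrow> \<exists>t\<in>pverts T. u \<in> X t \<and> v \<in> X t"
    and conn: "\<And>u. u \<in> verts G \<Longrightarrow>
      Digraph_Component.connected (with_proj T \<restriction> {t \<in> pverts T. u \<in> X t})"
    using td unfolding tree_decomposition_def dominates_graph_power_iff V by blast+
  \<comment> \<open>Powers have no loops, so the case \<open>u = v\<close> comes from
    \<open>cover\<close>. It does occur below: the inner vertices \<open>u'\<close> and
    \<open>v'\<close> may coincide.\<close>
  have near: "\<exists>t\<in>pverts T. u \<in> X t \<and> v \<in> X t" if "?d u v k" for u v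
    using edge cover that graph_dist_le_in_verts by (cases "u = v") blast+
  interpret T: graph "with_proj T" using T by (simp add: undirected_tree_def)
  have sub: "nbhd_bags G X t \<subseteq> verts G" for t
    using graph_dist_le_in_verts unfolding nbhd_bags_def by blast
  have cover': "\<exists>t\<in>pverts T. u \<in> nbhd_bags G X t" if "u \<in> verts G" for u
    using cover[OF that] graph_dist_refl_le[OF that] unfolding nbhd_bags_def by blast
  have edge': "\<exists>t\<in>pverts T. u \<in> nbhd_bags G X t \<and> v \<in> nbhd_bags G X t" if "?d u v (k + 2)" for u v
  proof -
    \<comment> \<open>Regrouped for two cuts, which leave end pieces of length at most 1 and a
      middle piece of length at most \<open>k\<close>.\<close>
    from that have "?d u v (1 + (k + 1))" by (simp add: ac_simps)
    then obtain u' where u': "?d u u' 1" "?d u' v (k + 1)" by (rule graph_dist_le_split)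
    from u'(2) obtain v' where v': "?d u' v' k" "?d v' v 1" by (rule graph_dist_le_split)
    from near[OF v'(1)] u'(1) graph_dist_commute_le[OF v'(2)] show ?thesis
      unfolding nbhd_bags_def by blast
  qed
  have conn': "Digraph_Component.connected (with_proj T \<restriction> {t \<in> pverts T. u \<in> nbhd_bags G X t})"
    if u: "u \<in> verts G" for u
  proof -
    let ?N = "\<lambda>w. {t \<in> pverts T. w \<in> X t}"
    let ?B = "?N ` {w. ?d u w 1}"
    have "?N u \<inter> ?N w \<noteq> {}" if "?d u w 1" for w
    proof -
      \<comment> \<open>The assumption \<open>k \<ge> 1\<close> enters here: neighbours in
        \<open>G\<close> are adjacent in the \<open>k\<close>-th power and hence share an old
        bag.\<close>
      have "?d u w k" using that \<open>k \<ge> 1\<close> by (auto intro: order_trans)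
      from near[OF this] show ?thesis by blast
    qed
    then have "Digraph_Component.connected (with_proj T \<restriction> (?N u \<union> \<Union>?B))"
      by (intro T.connected_induce_subgraph_Union) (use conn u graph_dist_le_in_verts(2)[of u _ 1] in auto)
    moreover have "?N u \<union> \<Union>?B = {t \<in> pverts T. u \<in> nbhd_bags G X t}"
      using graph_dist_refl_le[OF u] unfolding nbhd_bags_def by blast
    ultimately show ?thesis by simp
  qed
  show ?thesis
    unfolding tree_decomposition_def dominates_graph_power_iff V
    using T sub cover' edge' conn' by blast
qed

text \<open>Moving both ends of a pair by at most 1 lowers their distance by at most 2, exactly the
  gap between the two powers.\<close>

lemma (in graph) independence_number_nbhd_bags_le:
  assumes X: "X t \<subseteq> verts G"
  shows "independence_number (with_proj (graph_power G (k + 2)) \<restriction> nbhd_bags G X t)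
    \<le> independence_number (with_proj (graph_power G k) \<restriction> X t)"
proof (rule independence_number_le)
  let ?d = "\<lambda>u v i. graph_dist G u v \<le> ereal (real i)"
  have "nbhd_bags G X t \<subseteq> verts G"
    using graph_dist_le_in_verts unfolding nbhd_bags_def by blast
  then show "finite (verts (with_proj (graph_power G (k + 2)) \<restriction> nbhd_bags G X t))"
    by (auto intro: finite_subset)
  show "finite (verts (with_proj (graph_power G k) \<restriction> X t))"
    using X by (auto intro: finite_subset)
  fix S assume "independent_set (with_proj (graph_power G (k + 2)) \<restriction> nbhd_bags G X t) S"
  then have S: "S \<subseteq> nbhd_bags G X t"
    and far: "\<And>u v. u \<in> S \<Longrightarrow> v \<in> S \<Longrightarrow> ?d u v (k + 2) \<Longrightarrow> u = v"
    unfolding independent_set_def dominates_induce_subgraph_iff dominates_graph_power_iff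
      induce_subgraph_verts by blast+
  from S have "\<forall>u\<in>S. \<exists>w. w \<in> X t \<and> ?d u w 1" unfolding nbhd_bags_def by blast
  then obtain f where f: "\<And>u. u \<in> S \<Longrightarrow> f u \<in> X t" "\<And>u. u \<in> S \<Longrightarrow> ?d u (f u) 1"
    by metis
  have close: "u = v" if "u \<in> S" "v \<in> S" "?d (f u) (f v) k" for u v
  proof -
    have "?d u v (1 + k + 1)"
      using graph_dist_le_trans[OF graph_dist_le_trans[OF f(2)[OF that(1)] that(3)]
        graph_dist_commute_le[OF f(2)[OF that(2)]]] .
    then show ?thesis using far that(1,2) by (simp add: ac_simps)
  qed
  \<comment> \<open>Equal images are at distance 0, which is at most \<open>k\<close>, so
    \<open>close\<close> applies. Thus \<open>f\<close> preserves the cardinality of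
    \<open>S\<close>.\<close>
  have "inj_on f S"
    using close f(1) X graph_dist_refl_le by (intro inj_onI) (metis subsetD)
  moreover have "independent_set (with_proj (graph_power G k) \<restriction> X t) (f ` S)"
    unfolding independent_set_def dominates_induce_subgraph_iff dominates_graph_power_iff
      induce_subgraph_verts using close f(1) by blast
  ultimately show "\<exists>S'. independent_set (with_proj (graph_power G k) \<restriction> X t) S' \<and> card S \<le> card S'"
    by (metis card_image order_refl)
qed

lemma (in graph) decomposition_alpha_nbhd_bags_le:
  assumes td: "tree_decomposition (with_proj (graph_power G k)) T X"
  shows "decomposition_alpha (with_proj (graph_power G (k + 2))) T (nbhd_bags G X)
    \<le> decomposition_alpha (with_proj (graph_power G k)) T X"
proof -
  from td have T: "undirected_tree (with_proj T)"
    and X: "\<And>t. t \<in> pverts T \<Longrightarrow> X t \<subseteq> verts G"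
    by (auto simp: tree_decomposition_def graph_power_def)
  interpret T: graph "with_proj T" using T by (simp add: undirected_tree_def)
  have fin: "finite (pverts T)" using T.finite_verts by simp
  show ?thesis
    unfolding decomposition_alpha_def
  proof (rule Max.boundedI)
    show "(\<lambda>t. independence_number (with_proj (graph_power G (k + 2)) \<restriction> nbhd_bags G X t)) ` pverts T
        \<noteq> {}"
      \<comment> \<open>A connected tree has a node, so the maximum is taken over a nonempty
        set.\<close>
      using T
      by (auto simp: undirected_tree_def Digraph_Component.connected_def strongly_connected_def)
    fix n
    assume "n \<in> (\<lambda>t. independence_number (with_proj (graph_power G (k + 2)) \<restriction> nbhd_bags G X t)) ` pverts T"
    then obtain t where t: "t \<in> pverts T"
      and n: "n = independence_number (with_proj (graph_power G (k + 2)) \<restriction> nbhd_bags G X t)"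
      by blast
    have "n \<le> independence_number (with_proj (graph_power G k) \<restriction> X t)"
      unfolding n by (rule independence_number_nbhd_bags_le) (rule X[OF t])
    also have "\<dots> \<le> Max ((\<lambda>t. independence_number (with_proj (graph_power G k) \<restriction> X t)) ` pverts T)"
      using fin t by (intro Max.coboundedI) auto
    finally show "n \<le> Max ((\<lambda>t. independence_number (with_proj (graph_power G k) \<restriction> X t)) ` pverts T)" .
  qed (use fin in simp)
qed

theorem theorem3p3:
  fixes G :: "('a,'b) pre_digraph" and k :: nat
  assumes "graph G" and "k \<ge> 1"
  shows "tree_alpha (with_proj (graph_power G (k + 2))) \<le> tree_alpha (with_proj (graph_power G k))"
proof -
  interpret graph G by (rule assms(1))
  obtain T :: "nat pair_pre_digraph" and X
    where td: "tree_decomposition (with_proj (graph_power G k)) T X"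
      and eq: "tree_alpha (with_proj (graph_power G k))
        = decomposition_alpha (with_proj (graph_power G k)) T X"
    using graph.tree_alpha_attained[OF graph_graph_power] by blast
  have "tree_alpha (with_proj (graph_power G (k + 2)))
      \<le> decomposition_alpha (with_proj (graph_power G (k + 2))) T (nbhd_bags G X)"
    \<comment> \<open>The tree is still \<open>T\<close>, with nodes of type \<open>nat\<close>, so
      the enlarged decomposition competes in the minimum for the higher power.\<close>
    unfolding tree_alpha_def
    using tree_decomposition_nbhd_bags[OF td assms(2)] by (intro Least_le) blast
  also have "\<dots> \<le> decomposition_alpha (with_proj (graph_power G k)) T X"
    by (rule decomposition_alpha_nbhd_bags_le[OF td])
  finally show ?thesis by (simp only: eq)
qed

end
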